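(* Let $(X,d)$ be an unbounded metric space. An ultrafilter $p\in X^{\sharp}$ is strongly prime if and only if there exists $A\in Sp_X$ such that $A\in p$. Consequently, $Sp_X^{\wedge}=\mathrm{cl}\,\mathcal{D}$, where $\mathcal{D}\subseteq X^{\sharp}$ is the set of all divisible ultrafilters.
   Context: $\beta X$ is the Stone-Čech compactification of $X$ regarded as a discrete space (not with the metric topology): its points are the ultrafilters on $X$, and the sets $\bar A=\{p\in\beta X: A\in p\}$, $A\subseteq X$, form a base of the topology; $\mathrm{cl}$ denotes closure in $\beta X$. For $x\in X$, $A\subseteq X$, $r\ge 0$: $B(x,r)=\{y\in X: d(x,y)\le r\}$, $B(A,r)=\bigcup_{a\in A}B(a,r)$. A subset is bounded if it is contained in some ball $B(x,r)$. $X^{\sharp}$ is the set of all $p\in\beta X$ such that every $P\in p$ is unbounded in $X$ (a closed subset of $\beta X$). Two ultrafilters $p,q\in\beta X$ are parallel, $p\,||\,q$, if there exists $r\ge 0$ such that $B(P,r)\in q$ for each $P\in p$ (this is an equivalence relation). For $q\in X^{\sharp}$, $q^{=}=\{r\in X^{\sharp}: r\,||\,q\}$. An ultrafilter $p\in X^{\sharp}$ is divisible if there exists $q\in X^{\sharp}$ such that $\bar P\cap q^{=}$ is infinite for each $P\in p$. An ultrafilter $p\in X^{\sharp}$ is strongly prime if $p$ is not in the closure of the set of all divisible ultrafilters. A subset $A\subseteq X$ is sparse if $\bar A\cap q^{=}$ is finite for each $q\in X^{\sharp}$. $Sp_X$ is the family of all sparse subsets of $X$; it is an ideal in the Boolean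 algebra $\mathcal{P}_X$ of all subsets of $X$. For an ideal $\mathcal{I}$ in $\mathcal{P}_X$, $\mathcal{I}^{\wedge}=\{p\in\beta X: X\setminus A\in p \text{ for every } A\in\mathcal{I}\}$. *)

theory Defs
  imports "HOL-Analysis.Analysis"
begin

text \<open>
  The metric space \<open>X\<close> is the whole type \<open>'a::metric_space\<close>. Its metric topology plays no role:
  ultrafilters on \<open>X\<close> as a bare set are the maximal proper filters of type \<open>'a filter\<close>, a filter
  being identified with the family of its member sets.
\<close>

definition member :: "'a set \<Rightarrow> 'a filter \<Rightarrow> bool"
  where "member A p \<longleftrightarrow> eventually (\<lambda>x. x \<in> A) p"

definition ultrafilters :: "'a filter set"
  where "ultrafilters = {p. p \<noteq> bot \<and> (\<forall>A. member A p \<or> member (- A) p)}"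

definition stone :: "'a set \<Rightarrow> 'a filter set"
  where "stone A = {p \<in> ultrafilters. member A p}"

text \<open>
  The sets \<open>stone A\<close> are closed under finite intersections, so they form a base (not just a
  subbase) of the topology they generate; see \<open>openin_beta_iff\<close>.
\<close>

definition beta :: "'a filter topology"
  where "beta = topology_generated_by (range stone)"

lemma stone_Int: "stone A \<inter> stone B = stone (A \<inter> B)"
  by (auto simp: stone_def member_def eventually_conj_iff)

lemma stone_UNIV: "stone UNIV = ultrafilters"
  by (auto simp: stone_def member_def)

lemma topspace_beta: "topspace beta = (ultrafilters :: 'a filter set)"
proof -
  have "stone A \<subseteq> stone UNIV" for A :: "'a set"
    by (auto simp: stone_def member_def)
  then have "\<Union> (range stone) = (stone UNIV :: 'a filter set)"
    by blast
  then show ?thesis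
    by (simp add: beta_def topology_generated_by_topspace stone_UNIV)
qed

lemma openin_beta_iff:
  "openin beta U \<longleftrightarrow> U \<subseteq> ultrafilters \<and> (\<forall>p\<in>U. \<exists>A. p \<in> stone A \<and> stone A \<subseteq> U)"
proof
  assume "openin beta U"
  then have "generate_topology_on (range stone) U"
    by (simp add: beta_def openin_topology_generated_by_iff)
  then have "\<forall>p\<in>U. \<exists>A. p \<in> stone A \<and> stone A \<subseteq> U"
  proof induction
    case (Int a b)
    show ?case
    proof
      fix p assume "p \<in> a \<inter> b"
      with Int.IH obtain A B where "p \<in> stone A" "stone A \<subseteq> a" "p \<in> stone B" "stone B \<subseteq> b"
        by blast
      then have "p \<in> stone (A \<inter> B) \<and> stone (A \<inter> B) \<subseteq> a \<inter> b"
        by (auto simp flip: stone_Int)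
      then show "\<exists>A. p \<in> stone A \<and> stone A \<subseteq> a \<inter> b" ..
    qed
  next
    case (UN K)
    then show ?case by (meson Union_iff Union_upper subset_trans)
  qed auto
  with \<open>openin beta U\<close> show "U \<subseteq> ultrafilters \<and> (\<forall>p\<in>U. \<exists>A. p \<in> stone A \<and> stone A \<subseteq> U)"
    using openin_subset topspace_beta by blast
next
  assume *: "U \<subseteq> ultrafilters \<and> (\<forall>p\<in>U. \<exists>A. p \<in> stone A \<and> stone A \<subseteq> U)"
  have "openin beta (stone A)" for A
    by (simp add: beta_def topology_generated_by_Basis)
  with * show "openin beta U"
    by (subst openin_subopen) blast
qed

definition set_ball :: "'a::metric_space set \<Rightarrow> real \<Rightarrow> 'a set"
  where "set_ball A r = (\<Union>a\<in>A. cball a r)"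

definition corona :: "'a::metric_space filter set"
  where "corona = {p \<in> ultrafilters. \<forall>P. member P p \<longrightarrow> \<not> bounded P}"

definition parallel :: "'a::metric_space filter \<Rightarrow> 'a filter \<Rightarrow> bool"
  where "parallel p q \<longleftrightarrow> (\<exists>r\<ge>0. \<forall>P. member P p \<longrightarrow> member (set_ball P r) q)"

definition parallel_class :: "'a::metric_space filter \<Rightarrow> 'a filter set"
  where "parallel_class q = {r \<in> corona. parallel r q}"

definition divisible :: "'a::metric_space filter set"
  where "divisible =
    {p \<in> corona. \<exists>q\<in>corona. \<forall>P. member P p \<longrightarrow> infinite (stone P \<inter> parallel_class q)}"

definition strongly_prime :: "'a::metric_space filter set"
  where "strongly_prime = {p \<in> corona. p \<notin> beta closure_of divisible}"

definition sparse_sets :: "'a::metric_space set set"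
  where "sparse_sets = {A. \<forall>q\<in>corona. finite (stone A \<inter> parallel_class q)}"

definition ideal_dual :: "'a set set \<Rightarrow> 'a filter set"
  where "ideal_dual I = {p \<in> ultrafilters. \<forall>A\<in>I. member (- A) p}"

end

theory Submission
  imports Defs
begin

text \<open>
  Both claims are instances of one description of the closure: an ultrafilter lies in the closure
  of the divisible ultrafilters exactly when it has no sparse member
  (\<open>closure_of_divisible\<close>). For this it suffices to compare a set \<open>A\<close> with its basic open set
  \<open>stone A\<close> and to show that \<open>A\<close> is sparse iff \<open>stone A\<close> contains no divisible ultrafilter
  (\<open>sparse_iff_no_divisible\<close>).

  If \<open>A\<close> is sparse, then \<open>A\<close> itself is the member at which every ultrafilter in \<open>stone A\<close> fails to
  be divisible. If \<open>A\<close> is not sparse, then \<open>stone A\<close> contains infinitely many ultrafilters of one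
  parallel class. By compactness of \<open>\<beta>X\<close> these accumulate at some ultrafilter
  (\<open>infinite_ultrafilters_accumulate\<close>). As \<open>stone A\<close> and the corona are closed, this accumulation
  point lies in both of them, and it is divisible because all its neighbourhoods meet the parallel
  class infinitely often.
\<close>

text \<open>
  In the order of \<^typ>\<open>'a filter\<close> a filter with more members is smaller, so Zorn's lemma has
  to produce a minimal filter among those below \<open>F\<close> other than \<open>bot\<close>. If such a filter
  does not have \<open>- A\<close> as a member, restricting it to \<open>A\<close> keeps it proper and so changes nothing.
\<close>

lemma ultrafilter_below:
  fixes F :: "'a filter"
  assumes "F \<noteq> bot"
  shows "\<exists>p\<in>ultrafilters. p \<le> F"
proof -
  let ?S = "{G. G \<noteq> bot \<and> G \<le> F}"
  have "\<exists>m\<in>?S. \<forall>a\<in>?S. a \<le> m \<longrightarrow> a = m"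
  proof (rule predicate_Zorn[where P = "\<lambda>x y. y \<le> x"])
    show "partial_order_on ?S (relation_of (\<lambda>x y. y \<le> x) ?S)"
      by (rule partial_order_on_relation_ofI) auto
  next
    fix C assume C: "C \<in> Chains (relation_of (\<lambda>x y. y \<le> x) ?S)"
    have sub: "C \<subseteq> ?S" and chain: "\<And>x y. x \<in> C \<Longrightarrow> y \<in> C \<Longrightarrow> x \<le> y \<or> y \<le> x"
      using C by (auto simp: Chains_def relation_of_def)
    show "\<exists>u\<in>?S. \<forall>a\<in>C. u \<le> a"
    proof (cases "C = {}")
      case True
      with assms show ?thesis by auto
    next
      case False
      have "\<exists>x\<in>C. x \<le> inf a b" if "a \<in> C" "b \<in> C" for a b
        using chain[OF that] that by auto
      then have "eventually (\<lambda>_. False) (Inf C) \<longleftrightarrow> (\<exists>b\<in>C. eventually (\<lambda>_. False) b)"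
        by (rule eventually_Inf_base[OF False])
      with sub have "Inf C \<noteq> bot"
        by (auto simp: eventually_False)
      moreover obtain c where "c \<in> C" "c \<le> F"
        using False sub by blast
      then have "Inf C \<le> F"
        by (rule Inf_lower2)
      ultimately show ?thesis
        by (auto intro: Inf_lower)
    qed
  qed
  then obtain m where "m \<noteq> bot" "m \<le> F"
    and minimal: "\<And>a. a \<noteq> bot \<Longrightarrow> a \<le> F \<Longrightarrow> a \<le> m \<Longrightarrow> a = m"
    by blast
  have "member A m \<or> member (- A) m" for A
  proof (cases "inf m (principal A) = bot")
    case True
    then have "member (- A) m"
      by (auto simp: member_def eventually_inf_principal simp flip: eventually_False)
    then show ?thesis ..
  next
    case False
    then have "inf m (principal A) = m"
      using \<open>m \<le> F\<close> by (intro minimal) (auto intro: le_infI1)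
    then have "m \<le> principal A"
      by (simp add: inf.absorb_iff1)
    then show ?thesis
      by (simp add: le_principal member_def)
  qed
  with \<open>m \<noteq> bot\<close> have "m \<in> ultrafilters"
    by (simp add: ultrafilters_def)
  with \<open>m \<le> F\<close> show ?thesis by blast
qed

lemma ultrafilter_member_Compl:
  assumes "p \<in> ultrafilters"
  shows "member (- A) p \<longleftrightarrow> \<not> member A p"
proof -
  have "p = bot" if "member A p" "member (- A) p"
    using eventually_conj[OF that[unfolded member_def]] by (simp add: eventually_False)
  with assms show ?thesis
    by (auto simp: ultrafilters_def)
qed

text \<open>
  This is compactness of \<open>\<beta>X\<close> in the form that every infinite set has an accumulation point. The
  sets belonging to all but finitely many elements of \<open>Q\<close> form a proper filter. An ultrafilter
  that refines it cannot have a member belonging to only finitely many elements of \<open>Q\<close>, since the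
  complement of that member is in the filter.
\<close>

lemma infinite_ultrafilters_accumulate:
  assumes Q: "infinite Q" "Q \<subseteq> ultrafilters"
  shows "\<exists>r\<in>ultrafilters. \<forall>P. member P r \<longrightarrow> infinite (stone P \<inter> Q)"
proof -
  define F where "F = Abs_filter (\<lambda>P. finite {u \<in> Q. \<not> eventually P u})"
  have eventually_F: "eventually P F \<longleftrightarrow> finite {u \<in> Q. \<not> eventually P u}" for P
    unfolding F_def
  proof (rule eventually_Abs_filter, rule is_filter.intro)
    fix P R assume fin: "finite {u \<in> Q. \<not> eventually P u}" "finite {u \<in> Q. \<not> eventually R u}"
    show "finite {u \<in> Q. \<not> eventually (\<lambda>x. P x \<and> R x) u}"
      by (rule finite_subset[OF _ finite_UnI[OF fin]]) (auto simp: eventually_conj_iff)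
  next
    fix P R :: "'a \<Rightarrow> bool"
    assume "\<forall>x. P x \<longrightarrow> R x" and fin: "finite {u \<in> Q. \<not> eventually P u}"
    then show "finite {u \<in> Q. \<not> eventually R u}"
      by (intro finite_subset[OF _ fin]) (auto intro: eventually_mono)
  qed simp
  have "{u \<in> Q. \<not> eventually (\<lambda>_. False) u} = Q"
    using Q(2) by (auto simp: ultrafilters_def eventually_False)
  then have "F \<noteq> bot"
    using Q(1) eventually_F[of "\<lambda>_. False"] by (simp add: eventually_False)
  then obtain r where r: "r \<in> ultrafilters" "r \<le> F"
    using ultrafilter_below by blast
  have "infinite (stone P \<inter> Q)" if "member P r" for P
  proof
    assume "finite (stone P \<inter> Q)"
    moreover have "stone P \<inter> Q = {u \<in> Q. \<not> member (- P) u}"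
      using Q(2) by (auto simp: stone_def ultrafilter_member_Compl)
    ultimately have "eventually (\<lambda>x. x \<in> - P) F"
      by (simp add: eventually_F member_def)
    then have "member (- P) r"
      unfolding member_def by (rule filter_leD[OF r(2)])
    with that r(1) show False
      by (simp add: ultrafilter_member_Compl)
  qed
  with r(1) show ?thesis by blast
qed

lemma sparse_iff_no_divisible:
  "A \<in> sparse_sets \<longleftrightarrow> stone A \<inter> divisible = {}"
proof
  assume "A \<in> sparse_sets"
  then show "stone A \<inter> divisible = {}"
    unfolding sparse_sets_def divisible_def stone_def by blast
next
  assume disjoint: "stone A \<inter> divisible = {}"
  show "A \<in> sparse_sets"
  proof (rule ccontr)
    assume "A \<notin> sparse_sets"
    then obtain q where q: "q \<in> corona" "infinite (stone A \<inter> parallel_class q)"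
      by (auto simp: sparse_sets_def)
    have "stone A \<inter> parallel_class q \<subseteq> ultrafilters"
      by (auto simp: stone_def)
    with q(2) obtain r where r: "r \<in> ultrafilters"
      and acc: "\<And>P. member P r \<Longrightarrow> infinite (stone P \<inter> (stone A \<inter> parallel_class q))"
      using infinite_ultrafilters_accumulate by meson
    have "member A r"
    proof (rule ccontr)
      assume "\<not> member A r"
      then have "infinite (stone (- A) \<inter> (stone A \<inter> parallel_class q))"
        using r by (intro acc) (simp add: ultrafilter_member_Compl)
      moreover have "stone (- A) \<inter> stone A = {}"
        by (auto simp: stone_def ultrafilter_member_Compl)
      ultimately show False
        by (simp flip: Int_assoc)
    qed
    have inf: "infinite (stone P \<inter> parallel_class q)" if "member P r" for P
      using acc[OF that] by (rule contrapos_nn) (auto elim: rev_finite_subset)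
    have "\<not> bounded P" if "member P r" for P
    proof -
      have "stone P \<inter> parallel_class q \<noteq> {}"
        using inf[OF that] by force
      then show ?thesis
        by (auto simp: stone_def parallel_class_def corona_def)
    qed
    with r q(1) inf have "r \<in> divisible"
      by (auto simp: divisible_def corona_def)
    with \<open>member A r\<close> r disjoint show False
      by (auto simp: stone_def)
  qed
qed

lemma in_closure_of_beta_iff:
  "p \<in> beta closure_of D \<longleftrightarrow> p \<in> ultrafilters \<and> (\<forall>A. member A p \<longrightarrow> stone A \<inter> D \<noteq> {})"
proof -
  have "openin beta (stone A)" for A :: "'a set"
    by (simp add: beta_def topology_generated_by_Basis)
  then have "(\<forall>U. p \<in> U \<and> openin beta U \<longrightarrow> (\<exists>y\<in>D. y \<in> U)) \<longleftrightarrow>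
      (\<forall>A. p \<in> stone A \<longrightarrow> stone A \<inter> D \<noteq> {})"
    by (meson openin_beta_iff disjoint_iff subsetD)
  then show ?thesis
    by (auto simp: in_closure_of topspace_beta stone_def)
qed

lemma closure_of_divisible:
  "p \<in> beta closure_of divisible \<longleftrightarrow> p \<in> ultrafilters \<and> (\<forall>A\<in>sparse_sets. \<not> member A p)"
  by (auto simp: in_closure_of_beta_iff sparse_iff_no_divisible)

theorem proposition4:
  assumes "\<not> bounded (UNIV :: 'a::metric_space set)"
  shows "(\<forall>p\<in>corona. (p :: 'a filter) \<in> strongly_prime \<longleftrightarrow> (\<exists>A\<in>sparse_sets. member A p)) \<and>
    ideal_dual (sparse_sets :: 'a set set) = beta closure_of divisible"
proof
  show "\<forall>p\<in>corona. (p :: 'a filter) \<in> strongly_prime \<longleftrightarrow> (\<exists>A\<in>sparse_sets. member A p)"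
    by (auto simp: strongly_prime_def closure_of_divisible corona_def)
  show "ideal_dual (sparse_sets :: 'a set set) = beta closure_of divisible"
    by (auto simp: ideal_dual_def closure_of_divisible ultrafilter_member_Compl)
qed

end
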